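(* Let $(M,(\,,))$ be a connected Riemannian manifold of dimension $m\ge2$ and let $n\ge2$. Then there does not exist any proper harmonic map $\varphi:M\to\mathbb{R}^n$ such that $|d\varphi(x)|>0$ for every $x\in M$ and $\varphi(M)$ is contained in a non-degenerate cone of $\mathbb{R}^n$.
   Context: $\mathbb{R}^n$ carries its canonical flat metric $\langle\,,\rangle$. A non-degenerate cone of $\mathbb{R}^n$ is a set of the form $$\mathcal{C}_{o,v,\theta}=\Big\{z\in\mathbb{R}^n\setminus\{o\}:\Big\langle\frac{z-o}{|z-o|},v\Big\rangle\ge\cos(\theta)\Big\}$$ with vertex $o\in\mathbb{R}^n$, direction $v\in\mathbb{S}^{n-1}$ and width $\theta\in(0,\pi/2)$. $|d\varphi|$ is the Hilbert–Schmidt norm of $d\varphi$. Harmonic means that the tension field $\tau(\varphi)=\mathrm{tr}\,\nabla d\varphi$ vanishes identically. Proper means that preimages of compact sets are compact. No geodesic completeness of $M$ is assumed. *)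

theory Defs
  imports "HOL-Analysis.Analysis"
begin

section \<open>Smooth maps between normed spaces\<close>

text \<open>Only meant for open \<open>S\<close>. On a finite-dimensional domain, continuity of all iterated
  directional derivatives is the usual notion of being of class \<open>C\<^sup>k\<close>.\<close>

primrec Ck_on :: "nat \<Rightarrow> ('v::real_normed_vector \<Rightarrow> 'w::real_normed_vector) \<Rightarrow> 'v set \<Rightarrow> bool" where
  "Ck_on 0 f S \<longleftrightarrow> continuous_on S f"
| "Ck_on (Suc k) f S \<longleftrightarrow>
     (\<forall>x\<in>S. f differentiable (at x)) \<and> (\<forall>v. Ck_on k (\<lambda>x. frechet_derivative f (at x) v) S)"

definition smooth_on :: "('v::real_normed_vector \<Rightarrow> 'w::real_normed_vector) \<Rightarrow> 'v set \<Rightarrow> bool" where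
  "smooth_on f S \<longleftrightarrow> (\<forall>k. Ck_on k f S)"

definition partial :: "'m \<Rightarrow> (real^'m::finite \<Rightarrow> 'w::real_normed_vector) \<Rightarrow> real^'m \<Rightarrow> 'w" where
  "partial i f x = frechet_derivative f (at x) (axis i 1)"


section \<open>Smooth manifolds and Riemannian metrics\<close>

text \<open>A chart \<open>(U, \<psi>)\<close> consists of its domain and its coordinate map; the values of \<open>\<psi>\<close>
  outside \<open>U\<close> are irrelevant.\<close>

type_synonym ('a, 'm) chart = "'a set \<times> ('a \<Rightarrow> real^'m)"

definition coord_image :: "('a, 'm::finite) chart \<Rightarrow> (real^'m) set" where
  "coord_image c = snd c ` fst c"

definition in_coords :: "('a \<Rightarrow> 'w) \<Rightarrow> ('a, 'm::finite) chart \<Rightarrow> real^'m \<Rightarrow> 'w" where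
  "in_coords f c = f \<circ> inv_into (fst c) (snd c)"

text \<open>The atlas \<open>A\<close> need not be maximal. The dimension of the manifold is \<open>CARD('m)\<close>.\<close>

locale smooth_manifold =
  fixes X :: "'a topology" and A :: "('a, 'm::finite) chart set"
  assumes Hausdorff: "Hausdorff_space X"
    and second_countable: "second_countable X"
    and atlas_covers: "(\<Union>c\<in>A. fst c) = topspace X"
    and chart_domain_open: "c \<in> A \<Longrightarrow> openin X (fst c)"
    and coord_image_open: "c \<in> A \<Longrightarrow> open (coord_image c)"
    and chart_homeomorphic:
      "c \<in> A \<Longrightarrow> homeomorphic_map (subtopology X (fst c)) (top_of_set (coord_image c)) (snd c)"
    and transition_smooth:
      "\<lbrakk>c \<in> A; d \<in> A\<rbrakk> \<Longrightarrow> smooth_on (in_coords (snd d) c) (snd c ` (fst c \<inter> fst d))"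

text \<open>The metric is given by its coefficient matrices: \<open>G c x\<close> is the matrix \<open>(g\<^sub>i\<^sub>j)\<close> of the metric
  in the chart \<open>c\<close> at the point with coordinates \<open>x\<close>. The last axiom is the transformation law
  of a covariant 2-tensor.\<close>

locale riemannian_manifold = smooth_manifold X A
  for X :: "'a topology" and A :: "('a, 'm::finite) chart set" +
  fixes G :: "('a, 'm) chart \<Rightarrow> real^'m \<Rightarrow> real^'m^'m"
  assumes metric_smooth: "c \<in> A \<Longrightarrow> smooth_on (G c) (coord_image c)"
    and metric_symmetric: "\<lbrakk>c \<in> A; x \<in> coord_image c\<rbrakk> \<Longrightarrow> transpose (G c x) = G c x"
    and metric_pos_def: "\<lbrakk>c \<in> A; x \<in> coord_image c; v \<noteq> 0\<rbrakk> \<Longrightarrow> 0 < v \<bullet> (G c x *v v)"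
    and metric_transform:
      "\<lbrakk>c \<in> A; d \<in> A; x \<in> snd c ` (fst c \<inter> fst d);
        J = matrix (frechet_derivative (in_coords (snd d) c) (at x))\<rbrakk>
       \<Longrightarrow> G c x = transpose J ** G d (in_coords (snd d) c x) ** J"


section \<open>Differential, second fundamental form and tension field\<close>

text \<open>Trace \<open>g\<^sup>i\<^sup>j B\<^sub>i\<^sub>j\<close> of a (vector-valued) bilinear form with respect to the inner product
  with matrix \<open>g\<close>.\<close>

definition metric_trace :: "real^'m^'m \<Rightarrow> ('m::finite \<Rightarrow> 'm \<Rightarrow> 'w::real_vector) \<Rightarrow> 'w" where
  "metric_trace g B = (\<Sum>i\<in>UNIV. \<Sum>j\<in>UNIV. (matrix_inv g $ i $ j) *\<^sub>R B i j)"

text \<open>If the columns of \<open>E\<close> form a \<open>g\<close>-orthonormal basis, this is the sum of the values of the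
  form on the basis vectors.\<close>

lemma metric_trace_orthonormal:
  fixes g E :: "real^'m::finite^'m" and B :: "'m \<Rightarrow> 'm \<Rightarrow> 'w::real_vector"
  assumes "transpose E ** g ** E = mat 1"
  shows "metric_trace g B =
    (\<Sum>a\<in>UNIV. \<Sum>i\<in>UNIV. \<Sum>j\<in>UNIV. (E $ i $ a * E $ j $ a) *\<^sub>R B i j)"
proof -
  have 1: "E ** (transpose E ** g) = mat 1"
    using assms matrix_left_right_inverse by blast
  then have l: "(E ** transpose E) ** g = mat 1"
    by (simp add: matrix_mul_assoc)
  then have r: "g ** (E ** transpose E) = mat 1"
    using matrix_left_right_inverse by blast
  have inv: "matrix_inv g = E ** transpose E"
  proof -
    have "g ** matrix_inv g = mat 1 \<and> matrix_inv g ** g = mat 1"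
      unfolding matrix_inv_def using l r by (intro someI_ex[of "\<lambda>B. g ** B = mat 1 \<and> B ** g = mat 1"]) blast
    then show ?thesis
      using r by (metis matrix_mul_assoc matrix_mul_lid matrix_mul_rid)
  qed
  have "metric_trace g B =
      (\<Sum>i\<in>UNIV. \<Sum>j\<in>UNIV. \<Sum>a\<in>UNIV. (E $ i $ a * E $ j $ a) *\<^sub>R B i j)"
    by (simp add: metric_trace_def inv matrix_matrix_mult_def transpose_def scaleR_sum_left)
  also have "\<dots> = (\<Sum>i\<in>UNIV. \<Sum>a\<in>UNIV. \<Sum>j\<in>UNIV. (E $ i $ a * E $ j $ a) *\<^sub>R B i j)"
    by (intro sum.cong refl sum.swap)
  also have "\<dots> = (\<Sum>a\<in>UNIV. \<Sum>i\<in>UNIV. \<Sum>j\<in>UNIV. (E $ i $ a * E $ j $ a) *\<^sub>R B i j)"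
    by (rule sum.swap)
  finally show ?thesis .
qed

text \<open>\<open>christoffel g k i j\<close> is the symbol \<open>\<Gamma>\<^sup>k\<^sub>i\<^sub>j\<close> of the Levi-Civita connection of \<open>g\<close>.\<close>

definition christoffel ::
    "(real^'m \<Rightarrow> real^'m^'m) \<Rightarrow> 'm::finite \<Rightarrow> 'm \<Rightarrow> 'm \<Rightarrow> real^'m \<Rightarrow> real" where
  "christoffel g k i j x = (1/2) * (\<Sum>l\<in>UNIV. matrix_inv (g x) $ k $ l *
     (partial i (\<lambda>y. g y $ j $ l) x + partial j (\<lambda>y. g y $ i $ l) x
        - partial l (\<lambda>y. g y $ i $ j) x))"

text \<open>The components \<open>(\<nabla>df)(\<partial>\<^sub>i, \<partial>\<^sub>j)\<close>. As the target is a vector space with its flat metric,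
  only the Christoffel symbols of the domain appear.\<close>

definition second_fundamental_form ::
    "(real^'m \<Rightarrow> real^'m^'m) \<Rightarrow> (real^'m \<Rightarrow> 'w::euclidean_space) \<Rightarrow> real^'m \<Rightarrow> 'm::finite \<Rightarrow> 'm \<Rightarrow> 'w" where
  "second_fundamental_form g f x i j =
     partial i (partial j f) x - (\<Sum>k\<in>UNIV. christoffel g k i j x *\<^sub>R partial k f x)"

definition tension_field ::
    "(real^'m::finite \<Rightarrow> real^'m^'m) \<Rightarrow> (real^'m \<Rightarrow> 'w::euclidean_space) \<Rightarrow> real^'m \<Rightarrow> 'w" where
  "tension_field g f x = metric_trace (g x) (second_fundamental_form g f x)"

definition hilbert_schmidt_norm ::
    "(real^'m::finite \<Rightarrow> real^'m^'m) \<Rightarrow> (real^'m \<Rightarrow> 'w::euclidean_space) \<Rightarrow> real^'m \<Rightarrow> real" where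
  "hilbert_schmidt_norm g f x =
     sqrt (metric_trace (g x) (\<lambda>i j. partial i f x \<bullet> partial j f x))"

text \<open>Smoothness, vanishing of the tension field, and the value
  \<open>hilbert_schmidt_norm (G c) (in_coords \<phi> c) (snd c p)\<close>, which is \<open>|d\<phi>(p)|\<close>, do not depend
  on the chart \<open>c\<close> around \<open>p\<close>, so quantifying over all charts of the atlas is the same as
  choosing one chart around each point.\<close>

definition smooth_map :: "('a, 'm::finite) chart set \<Rightarrow> ('a \<Rightarrow> 'w::euclidean_space) \<Rightarrow> bool" where
  "smooth_map A \<phi> \<longleftrightarrow> (\<forall>c\<in>A. smooth_on (in_coords \<phi> c) (coord_image c))"

definition harmonic_map ::
    "('a, 'm::finite) chart set \<Rightarrow> (('a, 'm) chart \<Rightarrow> real^'m \<Rightarrow> real^'m^'m)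
      \<Rightarrow> ('a \<Rightarrow> 'w::euclidean_space) \<Rightarrow> bool" where
  "harmonic_map A G \<phi> \<longleftrightarrow> smooth_map A \<phi> \<and>
     (\<forall>c\<in>A. \<forall>p\<in>fst c. tension_field (G c) (in_coords \<phi> c) (snd c p) = 0)"


section \<open>Proper maps and cones\<close>

definition proper_into :: "'a topology \<Rightarrow> ('a \<Rightarrow> 'w::topological_space) \<Rightarrow> bool" where
  "proper_into X \<phi> \<longleftrightarrow> (\<forall>K. compact K \<longrightarrow> compactin X {p \<in> topspace X. \<phi> p \<in> K})"

definition cone_set :: "'w::euclidean_space \<Rightarrow> 'w \<Rightarrow> real \<Rightarrow> 'w set" where
  "cone_set a v \<theta> = {z. z \<noteq> a \<and> ((z - a) /\<^sub>R norm (z - a)) \<bullet> v \<ge> cos \<theta>}"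

definition nondegenerate_cone :: "'w::euclidean_space set \<Rightarrow> bool" where
  "nondegenerate_cone C \<longleftrightarrow>
     (\<exists>a v \<theta>. norm v = 1 \<and> 0 < \<theta> \<and> \<theta> < pi / 2 \<and> C = cone_set a v \<theta>)"

end

theory Submission
  imports Defs
begin

text \<open>Let \<open>C\<close> be a cone with vertex \<open>a\<close>, direction \<open>v\<close> and width \<open>\<theta>\<close>, and let
  \<open>F z = c \<surd>(1 + |z - a|\<^sup>2) - \<langle>z - a, v\<rangle>\<close> with \<open>2 c = cos \<theta>\<close>. This function is strictly convex
  and tends to \<open>-\<infinity>\<close> at infinity in \<open>C\<close>, so \<open>F \<circ> \<phi>\<close> attains its maximum, as \<open>\<phi>\<close> is proper.
  There the Laplacian of \<open>F \<circ> \<phi>\<close> is nonpositive; as \<open>\<phi>\<close> is harmonic, it is the trace of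
  \<open>Hess F (d\<phi>, d\<phi>)\<close>, which is positive if \<open>d\<phi> \<noteq> 0\<close>.\<close>

section \<open>Positive definite forms as sums of squares, and traces over a frame\<close>

text \<open>Cholesky factorization by induction on the index set: the pivot at a new index
  \<open>k\<close> is positive, and the Schur complement of \<open>P\<close> with respect to it is
  again symmetric and positive definite on \<open>S\<close>. Forms are functions on a finite set
  rather than matrices so that indices can be removed one at a time.\<close>

lemma positive_definite_decomposition:
  fixes P :: "'i \<Rightarrow> 'i \<Rightarrow> real"
  assumes "finite S"
    and "\<And>i j. i \<in> S \<Longrightarrow> j \<in> S \<Longrightarrow> P i j = P j i"
    and "\<And>x. \<exists>i\<in>S. x i \<noteq> 0 \<Longrightarrow> 0 < (\<Sum>i\<in>S. \<Sum>j\<in>S. x i * x j * P i j)"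
  shows "\<exists>E. \<forall>i\<in>S. \<forall>j\<in>S. P i j = (\<Sum>a\<in>S. E a i * E a j)"
  using assms
proof (induction S arbitrary: P rule: finite_induct)
  case empty
  then show ?case by simp
next
  case (insert k S)
  have quad: "(\<Sum>i\<in>insert k S. \<Sum>j\<in>insert k S. x i * x j * P i j) =
      x k * x k * P k k + 2 * x k * (\<Sum>i\<in>S. x i * P i k) + (\<Sum>i\<in>S. \<Sum>j\<in>S. x i * x j * P i j)"
    for x
  proof -
    have "(\<Sum>j\<in>S. x k * x j * P k j) = x k * (\<Sum>i\<in>S. x i * P i k)"
      unfolding sum_distrib_left using insert.prems(1) by (intro sum.cong) auto
    moreover have "(\<Sum>i\<in>S. x i * x k * P i k) = x k * (\<Sum>i\<in>S. x i * P i k)"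
      unfolding sum_distrib_left by (intro sum.cong) auto
    ultimately show ?thesis
      using insert.hyps by (simp add: sum.distrib)
  qed
  define p where "p = P k k"
  have p: "p > 0"
  proof -
    have "(\<Sum>i\<in>S. (if i = k then 1 else 0) * P i k) = 0"
      using insert.hyps by (intro sum.neutral) auto
    moreover have "(\<Sum>i\<in>S. \<Sum>j\<in>S. (if i = k then 1 else 0) * (if j = k then 1 else 0) * P i j) = 0"
      using insert.hyps by (intro sum.neutral ballI) auto
    ultimately show ?thesis
      using insert.prems(2)[of "\<lambda>i. if i = k then 1 else 0"] unfolding quad p_def by simp
  qed
  define P' where "P' i j = P i j - P i k * P j k / p" for i j
  have "\<exists>E. \<forall>i\<in>S. \<forall>j\<in>S. P' i j = (\<Sum>a\<in>S. E a i * E a j)"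
  proof (rule insert.IH)
    show "P' i j = P' j i" if "i \<in> S" "j \<in> S" for i j
      using that insert.prems(1) by (simp add: P'_def)
  next
    fix x :: "'i \<Rightarrow> real"
    assume nz: "\<exists>i\<in>S. x i \<noteq> 0"
    define b where "b = (\<Sum>i\<in>S. x i * P i k)"
    \<comment> \<open>The entry at \<open>k\<close> minimizes the polynomial in \<open>quad\<close>
      as a function of that entry; the minimum is the Schur complement form at
      \<open>x\<close>.\<close>
    define y where "y = x(k := - b / p)"
    have yS: "y i = x i" if "i \<in> S" for i
      using that insert.hyps by (auto simp: y_def)
    have "\<exists>i\<in>insert k S. y i \<noteq> 0"
      using nz yS by fastforce
    then have "0 < (\<Sum>i\<in>insert k S. \<Sum>j\<in>insert k S. y i * y j * P i j)"
      by (rule insert.prems(2))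
    also have "\<dots> = (b / p) * (b / p) * p - 2 * (b / p) * b + (\<Sum>i\<in>S. \<Sum>j\<in>S. x i * x j * P i j)"
      unfolding quad p_def[symmetric] using yS by (simp add: y_def b_def)
    also have "\<dots> = (\<Sum>i\<in>S. \<Sum>j\<in>S. x i * x j * P i j) - b * b / p"
      using p by (simp add: field_simps)
    also have "\<dots> = (\<Sum>i\<in>S. \<Sum>j\<in>S. x i * x j * P' i j)"
      unfolding P'_def b_def sum_product sum_divide_distrib sum_subtractf[symmetric]
      by (intro sum.cong refl) (simp add: field_simps)
    finally show "0 < (\<Sum>i\<in>S. \<Sum>j\<in>S. x i * x j * P' i j)" .
  qed
  then obtain E where E: "\<And>i j. i \<in> S \<Longrightarrow> j \<in> S \<Longrightarrow> P' i j = (\<Sum>a\<in>S. E a i * E a j)"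
    by blast
  \<comment> \<open>The vector with label \<open>k\<close> carries the rank-one term subtracted in
    \<open>P'\<close>. The others are set to 0 at the index \<open>k\<close>, where nothing is known
    about \<open>E\<close>.\<close>
  define E' where "E' a i = (if a = k then P i k / sqrt p else if i = k then 0 else E a i)" for a i
  have "P i j = (\<Sum>a\<in>insert k S. E' a i * E' a j)" if "i \<in> insert k S" "j \<in> insert k S" for i j
  proof -
    have "(\<Sum>a\<in>S. E' a i * E' a j) = (\<Sum>a\<in>S. if i = k \<or> j = k then 0 else E a i * E a j)"
      using insert.hyps by (intro sum.cong) (auto simp: E'_def)
    also have "\<dots> = (if i = k \<or> j = k then 0 else P' i j)"
      using that E by auto
    finally have "(\<Sum>a\<in>insert k S. E' a i * E' a j) =
        P i k * P j k / p + (if i = k \<or> j = k then 0 else P' i j)"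
      using insert.hyps p by (simp add: E'_def real_sqrt_mult[symmetric] power2_eq_square[symmetric])
    then show ?thesis
      using p insert.prems(1)[of i j] that by (auto simp: P'_def p_def)
  qed
  then show ?case by blast
qed

text \<open>The substitution \<open>v = g *v u\<close> turns the quadratic form of the inverse at
  \<open>v\<close> into that of \<open>g\<close> at \<open>u\<close>.\<close>

lemma positive_definite_inverse:
  fixes g :: "real^'m::finite^'m"
  assumes sym: "transpose g = g" and pos: "\<And>v. v \<noteq> 0 \<Longrightarrow> 0 < v \<bullet> (g *v v)"
  shows "transpose (matrix_inv g) = matrix_inv g"
    and "\<And>v. v \<noteq> 0 \<Longrightarrow> 0 < v \<bullet> (matrix_inv g *v v)"
proof -
  have "\<forall>x. g *v x = 0 \<longrightarrow> x = 0"
    using pos by force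
  then have "invertible g"
    by (metis invertible_left_inverse matrix_left_invertible_ker)
  then have inv: "g ** matrix_inv g = mat 1" "matrix_inv g ** g = mat 1"
    using someI_ex[of "\<lambda>B. g ** B = mat 1 \<and> B ** g = mat 1"]
    by (auto simp: invertible_def matrix_inv_def)
  have "transpose (matrix_inv g) ** g = mat 1"
    by (metis inv(1) matrix_transpose_mul sym transpose_mat)
  then show "transpose (matrix_inv g) = matrix_inv g"
    by (metis inv(1) matrix_mul_assoc matrix_mul_lid matrix_mul_rid)
  fix v :: "real^'m"
  assume "v \<noteq> 0"
  define u where "u = matrix_inv g *v v"
  have v: "v = g *v u"
    by (simp add: u_def matrix_vector_mul_assoc inv)
  then have "u \<noteq> 0" using \<open>v \<noteq> 0\<close> by auto
  then show "0 < v \<bullet> (matrix_inv g *v v)"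
    using pos[of u] by (simp add: u_def[symmetric] v[symmetric] inner_commute)
qed

lemma matrix_inv_decomposition:
  fixes g :: "real^'m::finite^'m"
  assumes "transpose g = g" and "\<And>v. v \<noteq> 0 \<Longrightarrow> 0 < v \<bullet> (g *v v)"
  shows "\<exists>e :: 'm \<Rightarrow> real^'m. \<forall>i j. matrix_inv g $ i $ j = (\<Sum>a\<in>UNIV. e a $ i * e a $ j)"
proof -
  have sym: "transpose (matrix_inv g) = matrix_inv g"
    using assms by (rule positive_definite_inverse(1))
  have pos: "0 < v \<bullet> (matrix_inv g *v v)" if "v \<noteq> 0" for v
    using assms that by (rule positive_definite_inverse(2))
  have "\<exists>E. \<forall>i\<in>UNIV. \<forall>j\<in>UNIV. matrix_inv g $ i $ j = (\<Sum>a\<in>(UNIV :: 'm set). E a i * E a j)"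
  proof (rule positive_definite_decomposition)
    show "matrix_inv g $ i $ j = matrix_inv g $ j $ i" for i j
      using arg_cong[OF sym, of "\<lambda>A. A $ j $ i"] by (simp add: transpose_def)
  next
    fix x :: "'m \<Rightarrow> real"
    assume "\<exists>i\<in>UNIV. x i \<noteq> 0"
    then have "(\<chi> i. x i) \<noteq> 0" by (simp add: vec_eq_iff)
    from pos[OF this] show "0 < (\<Sum>i\<in>UNIV. \<Sum>j\<in>UNIV. x i * x j * matrix_inv g $ i $ j)"
      by (simp add: inner_vec_def matrix_vector_mult_def sum_distrib_left mult_ac)
  qed simp
  then obtain E where E: "\<And>i j. matrix_inv g $ i $ j = (\<Sum>a\<in>(UNIV :: 'm set). E a i * E a j)"
    by auto
  then show ?thesis
    by (intro exI[of _ "\<lambda>a. \<chi> i. E a i"]) simp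
qed

text \<open>The \<open>e a\<close> are an orthonormal frame for \<open>g\<close>. Each term of the
  outer sum is the value of the form on one pair (\<open>e a\<close>, \<open>e a\<close>), so a
  second derivative test along the line in direction \<open>e a\<close> can control it.\<close>

lemma metric_trace_decomposition:
  fixes g :: "real^'m::finite^'m" and B :: "'m \<Rightarrow> 'm \<Rightarrow> 'w::real_vector"
  assumes "\<forall>i j. matrix_inv g $ i $ j = (\<Sum>a\<in>UNIV. e a $ i * e a $ j)"
  shows "metric_trace g B = (\<Sum>a\<in>UNIV. \<Sum>i\<in>UNIV. \<Sum>j\<in>UNIV. (e a $ i * e a $ j) *\<^sub>R B i j)"
proof -
  have "metric_trace g B = (\<Sum>i\<in>UNIV. \<Sum>j\<in>UNIV. \<Sum>a\<in>UNIV. (e a $ i * e a $ j) *\<^sub>R B i j)"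
    by (simp add: metric_trace_def assms scaleR_sum_left)
  also have "\<dots> = (\<Sum>i\<in>UNIV. \<Sum>a\<in>UNIV. \<Sum>j\<in>UNIV. (e a $ i * e a $ j) *\<^sub>R B i j)"
    by (intro sum.cong refl sum.swap)
  also have "\<dots> = (\<Sum>a\<in>UNIV. \<Sum>i\<in>UNIV. \<Sum>j\<in>UNIV. (e a $ i * e a $ j) *\<^sub>R B i j)"
    by (rule sum.swap)
  finally show ?thesis .
qed

section \<open>Second derivative test along lines in a chart\<close>

lemma second_derivative_at_local_max:
  fixes h :: "real \<Rightarrow> real"
  assumes "d > 0"
    and h': "\<And>t. \<bar>t\<bar> < d \<Longrightarrow> (h has_real_derivative h' t) (at t)"
    and h'': "(h' has_real_derivative l) (at 0)"
    and max: "\<And>t. \<bar>t\<bar> < d \<Longrightarrow> h t \<le> h 0"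
  shows "h' 0 = 0" and "l \<le> 0"
proof -
  show 0: "h' 0 = 0"
    using DERIV_local_max[OF h'[of 0] \<open>d > 0\<close>] max \<open>d > 0\<close> by auto
  show "l \<le> 0"
  proof (rule ccontr)
    \<comment> \<open>Then \<open>h'\<close> exceeds \<open>h' 0 = 0\<close> just to the right of 0,
      so \<open>h\<close> grows beyond its maximum.\<close>
    assume "\<not> l \<le> 0"
    then obtain e where e: "e > 0" "\<And>t. 0 < t \<Longrightarrow> t < e \<Longrightarrow> h' 0 < h' t"
      using DERIV_pos_inc_right[OF h''] by auto
    define s where "s = min d e / 2"
    have s: "0 < s" "s < d" "s < e"
      using e \<open>d > 0\<close> by (auto simp: s_def)
    have "\<exists>y. (h has_real_derivative y) (at t) \<and> y > 0" if "0 < t" "t < s" for t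
      using h'[of t] e(2)[of t] that s 0 by auto
    moreover have "isCont h t" if "t \<in> {0..s}" for t
      using DERIV_isCont[OF h'[of t]] that s by auto
    then have "continuous_on {0..s} h"
      by (intro continuous_at_imp_continuous_on) auto
    ultimately have "h 0 < h s"
      using DERIV_pos_imp_increasing_open[of 0 s h] s by auto
    then show False using max[of s] s by auto
  qed
qed

lemma has_vector_derivative_along_line:
  fixes f :: "real^'m::finite \<Rightarrow> 'w::real_normed_vector"
  assumes "f differentiable (at (x + t *\<^sub>R e))"
  shows "((\<lambda>t. f (x + t *\<^sub>R e)) has_vector_derivative
           (\<Sum>i\<in>UNIV. (e $ i) *\<^sub>R partial i f (x + t *\<^sub>R e))) (at t)"
proof -
  let ?D = "frechet_derivative f (at (x + t *\<^sub>R e))"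
  have D: "(f has_derivative ?D) (at (x + t *\<^sub>R e))"
    using assms frechet_derivative_works by blast
  then have lin: "linear ?D"
    by (rule has_derivative_linear)
  have "((\<lambda>t. x + t *\<^sub>R e) has_derivative (\<lambda>s. s *\<^sub>R e)) (at t)"
    by (auto intro!: derivative_eq_intros)
  from has_derivative_compose[OF this D]
  have "((\<lambda>t. f (x + t *\<^sub>R e)) has_derivative (\<lambda>s. s *\<^sub>R ?D e)) (at t)"
    by (simp add: linear_scale[OF lin])
  moreover have "?D e = (\<Sum>i\<in>UNIV. (e $ i) *\<^sub>R partial i f (x + t *\<^sub>R e))"
  proof -
    have "?D (\<Sum>i\<in>UNIV. (e $ i) *\<^sub>R axis i 1) = (\<Sum>i\<in>UNIV. (e $ i) *\<^sub>R partial i f (x + t *\<^sub>R e))"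
      by (simp add: linear_sum[OF lin] linear_scale[OF lin] partial_def)
    then show ?thesis
      using basis_expansion[of e] by (simp add: scalar_mult_eq_scaleR)
  qed
  ultimately show ?thesis
    by (simp add: has_vector_derivative_def)
qed

lemma smooth_on_differentiable:
  assumes "smooth_on f S" "y \<in> S"
  shows "f differentiable (at y)" and "partial i f differentiable (at y)"
proof -
  have "Ck_on (Suc (Suc 0)) f S"
    using assms by (auto simp: smooth_on_def)
  then show "f differentiable (at y)" and "partial i f differentiable (at y)"
    using assms(2) by (auto simp: partial_def[abs_def])
qed

text \<open>The hypotheses \<open>below\<close> and \<open>touch\<close> say that \<open>c \<surd>(1 + |f - a|\<^sup>2) - \<langle>f - a, v\<rangle>\<close> is
  maximal at \<open>x\<close>. The argument works with the squared inequality, which is polynomial in \<open>f\<close>.\<close>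

lemma second_derivative_touching_hyperboloid:
  fixes f :: "real^'m::finite \<Rightarrow> 'w::euclidean_space"
  assumes "open S" "x \<in> S" and smooth: "smooth_on f S" and "0 < c"
    and below: "\<And>y. y \<in> S \<Longrightarrow> c * sqrt (1 + (norm (f y - a))\<^sup>2) \<le> (f y - a) \<bullet> v + K"
    and touch: "c * sqrt (1 + (norm (f x - a))\<^sup>2) = (f x - a) \<bullet> v + K"
    and Y_def: "Y = 2 *\<^sub>R (c\<^sup>2 *\<^sub>R (f x - a) - ((f x - a) \<bullet> v + K) *\<^sub>R v)"
    and u_def: "u = (\<Sum>i\<in>UNIV. (e $ i) *\<^sub>R partial i f x)"
    and z_def: "z = (\<Sum>i\<in>UNIV. \<Sum>j\<in>UNIV. (e $ i * e $ j) *\<^sub>R partial i (partial j f) x)"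
  shows "Y \<bullet> u = 0"
    and "Y \<bullet> z + 2 * c\<^sup>2 / (1 + (norm (f x - a))\<^sup>2) * (u \<bullet> u) \<le> 0"
proof -
  define \<gamma> where "\<gamma> t = f (x + t *\<^sub>R e) - a" for t
  define \<gamma>' where "\<gamma>' t = (\<Sum>i\<in>UNIV. (e $ i) *\<^sub>R partial i f (x + t *\<^sub>R e))" for t
  \<comment> \<open>The difference of the squared sides of \<open>below\<close> along the line, with
    maximum 0 at \<open>t = 0\<close>; \<open>h'\<close> is its derivative.\<close>
  define h where "h t = c\<^sup>2 * (1 + \<gamma> t \<bullet> \<gamma> t) - (\<gamma> t \<bullet> v + K)\<^sup>2" for t
  define h' where "h' t = 2 * c\<^sup>2 * (\<gamma> t \<bullet> \<gamma>' t) - 2 * (\<gamma> t \<bullet> v + K) * (\<gamma>' t \<bullet> v)" for t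
  define w where "w = f x - a"
  define L where "L = w \<bullet> v + K"
  have at0: "\<gamma> 0 = w" "\<gamma>' 0 = u"
    by (simp_all add: \<gamma>_def \<gamma>'_def w_def u_def)
  have "open ((\<lambda>t. x + t *\<^sub>R e) -` S)"
    by (intro open_vimage \<open>open S\<close> continuous_intros)
  moreover have "0 \<in> (\<lambda>t. x + t *\<^sub>R e) -` S"
    using \<open>x \<in> S\<close> by simp
  ultimately obtain d where "d > 0" and "ball 0 d \<subseteq> (\<lambda>t. x + t *\<^sub>R e) -` S"
    by (rule openE)
  then have inS: "x + t *\<^sub>R e \<in> S" if "\<bar>t\<bar> < d" for t
    using that by (auto simp: subset_iff dist_real_def)
  have d1: "(\<gamma> has_vector_derivative \<gamma>' t) (at t)" if "\<bar>t\<bar> < d" for t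
    using has_vector_derivative_along_line[OF smooth_on_differentiable(1)[OF smooth inS[OF that]]]
    unfolding \<gamma>_def[abs_def] \<gamma>'_def by (auto intro!: derivative_eq_intros)
  have d2: "(\<gamma>' has_vector_derivative z) (at 0)"
  proof -
    have "((\<lambda>t. partial j f (x + t *\<^sub>R e)) has_vector_derivative
         (\<Sum>i\<in>UNIV. (e $ i) *\<^sub>R partial i (partial j f) x)) (at 0)" for j
      using has_vector_derivative_along_line[of "partial j f" x 0 e]
        smooth_on_differentiable(2)[OF smooth \<open>x \<in> S\<close>] by simp
    then have "((\<lambda>t. \<Sum>j\<in>UNIV. (e $ j) *\<^sub>R partial j f (x + t *\<^sub>R e)) has_vector_derivative
         (\<Sum>j\<in>UNIV. (e $ j) *\<^sub>R (\<Sum>i\<in>UNIV. (e $ i) *\<^sub>R partial i (partial j f) x))) (at 0)"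
      by (intro has_vector_derivative_sum bounded_linear.has_vector_derivative[OF bounded_linear_scaleR_right])
    moreover have "(\<Sum>j\<in>UNIV. (e $ j) *\<^sub>R (\<Sum>i\<in>UNIV. (e $ i) *\<^sub>R partial i (partial j f) x)) = z"
      unfolding z_def scaleR_sum_right by (subst sum.swap) (simp add: mult.commute)
    ultimately show ?thesis
      unfolding \<gamma>'_def[abs_def] by simp
  qed
  have dinner: "((\<lambda>t. \<alpha> t \<bullet> \<beta> t) has_real_derivative \<alpha> t \<bullet> \<beta>' + \<alpha>' \<bullet> \<beta> t) (at t)"
    if "(\<alpha> has_vector_derivative \<alpha>') (at t)" "(\<beta> has_vector_derivative \<beta>') (at t)"
    for \<alpha> \<beta> :: "real \<Rightarrow> 'w" and \<alpha>' \<beta>' t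
    using bounded_bilinear.has_vector_derivative[OF bounded_bilinear_inner that]
    by (simp add: has_real_derivative_iff_has_vector_derivative)
  have dv: "((\<lambda>t. \<alpha> t \<bullet> v) has_real_derivative \<alpha>' \<bullet> v) (at t)"
    if "(\<alpha> has_vector_derivative \<alpha>') (at t)" for \<alpha> \<alpha>' t
    using dinner[OF that has_vector_derivative_const[of v]] by simp
  have h': "(h has_real_derivative h' t) (at t)" if "\<bar>t\<bar> < d" for t
    unfolding h_def[abs_def] h'_def
    by (rule derivative_eq_intros dinner dv d1 that refl)+ (simp add: inner_commute algebra_simps)
  have h'': "(h' has_real_derivative
      2 * c\<^sup>2 * (w \<bullet> z + u \<bullet> u) - 2 * (u \<bullet> v) * (u \<bullet> v) - 2 * L * (z \<bullet> v)) (at 0)"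
  proof -
    have d0: "(\<gamma> has_vector_derivative u) (at 0)"
      using d1[of 0] \<open>d > 0\<close> by (simp add: at0)
    have "((\<lambda>t. \<gamma> t \<bullet> \<gamma>' t) has_real_derivative w \<bullet> z + u \<bullet> u) (at 0)"
      using dinner[OF d0 d2] by (simp add: at0)
    note [derivative_intros] = this dv[OF d0] dv[OF d2]
    show ?thesis
      unfolding h'_def[abs_def] L_def
      by (rule derivative_eq_intros refl)+ (simp add: at0 algebra_simps)
  qed
  have sq: "c\<^sup>2 * (1 + (norm s)\<^sup>2) = (c * sqrt (1 + (norm s)\<^sup>2))\<^sup>2" for s :: 'w
    by (simp add: power_mult_distrib)
  \<comment> \<open>Squaring keeps the inequality \<open>below\<close> because its left side is
    nonnegative.\<close>
  have "h t \<le> 0" if "\<bar>t\<bar> < d" for t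
  proof -
    have "(c * sqrt (1 + (norm (\<gamma> t))\<^sup>2))\<^sup>2 \<le> (\<gamma> t \<bullet> v + K)\<^sup>2"
      using below[OF inS[OF that]] \<open>0 < c\<close> unfolding \<gamma>_def by (intro power_mono) auto
    then show ?thesis
      unfolding sq[symmetric] by (simp add: h_def dot_square_norm)
  qed
  moreover have L2: "L\<^sup>2 = c\<^sup>2 * (1 + w \<bullet> w)"
    using touch sq[of w] by (simp add: L_def w_def dot_square_norm)
  then have "h 0 = 0"
    by (simp add: h_def at0 L_def)
  ultimately have max: "\<And>t. \<bar>t\<bar> < d \<Longrightarrow> h t \<le> h 0"
    by simp
  note test = second_derivative_at_local_max[OF \<open>d > 0\<close> h' h'' max]
  have crit: "L * (u \<bullet> v) = c\<^sup>2 * (w \<bullet> u)"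
    using test(1) by (simp add: h'_def at0 L_def algebra_simps)
  \<comment> \<open>\<open>Y\<close> is the gradient, at the target point \<open>f x\<close>, of the
    polynomial whose restriction to the curve \<open>\<gamma>\<close> is \<open>h\<close>.\<close>
  have Y: "Y \<bullet> s = 2 * (c\<^sup>2 * (w \<bullet> s) - L * (s \<bullet> v))" for s
    by (simp add: Y_def w_def[symmetric] L_def[symmetric] inner_diff_left inner_commute[of v])
  show "Y \<bullet> u = 0"
    by (simp add: Y crit)
  \<comment> \<open>The second derivative of \<open>h\<close> at 0 is \<open>Y \<bullet> z\<close>
    plus twice \<open>c\<^sup>2 * (u \<bullet> u) - (u \<bullet> v)\<^sup>2\<close>, which can be
    negative for general \<open>u\<close>. Squaring \<open>crit\<close>, replacing
    \<open>L\<^sup>2\<close> by \<open>L2\<close> and applying Cauchy-Schwarz to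
    \<open>w \<bullet> u\<close> bounds it below by \<open>r\<close>: strict convexity in tangential
    directions.\<close>
  define r where "r = c\<^sup>2 / (1 + w \<bullet> w) * (u \<bullet> u)"
  have pos: "1 + w \<bullet> w > 0"
    by (simp add: add_pos_nonneg)
  have "(L * (u \<bullet> v))\<^sup>2 = c\<^sup>2 * (c\<^sup>2 * (w \<bullet> u)\<^sup>2)"
    unfolding crit by (simp add: power2_eq_square)
  then have "c\<^sup>2 * ((1 + w \<bullet> w) * (u \<bullet> v)\<^sup>2) = c\<^sup>2 * (c\<^sup>2 * (w \<bullet> u)\<^sup>2)"
    by (simp add: power_mult_distrib L2 mult.assoc)
  then have "(1 + w \<bullet> w) * (u \<bullet> v)\<^sup>2 = c\<^sup>2 * (w \<bullet> u)\<^sup>2"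
    by (subst (asm) mult_left_cancel) (use \<open>0 < c\<close> in simp_all)
  also have "\<dots> \<le> c\<^sup>2 * ((w \<bullet> w) * (u \<bullet> u))"
    by (intro mult_left_mono Cauchy_Schwarz_ineq) simp
  finally have r: "r \<le> c\<^sup>2 * (u \<bullet> u) - (u \<bullet> v)\<^sup>2"
    using pos by (simp add: r_def field_simps)
  have "Y \<bullet> z + 2 * r \<le> 0"
    using r test(2) by (simp add: Y power2_eq_square[of "u \<bullet> v"] algebra_simps)
  then show "Y \<bullet> z + 2 * c\<^sup>2 / (1 + (norm (f x - a))\<^sup>2) * (u \<bullet> u) \<le> 0"
    by (simp add: r_def w_def dot_square_norm)
qed

section \<open>Trace of the second derivative test at a touching point\<close>

text \<open>Summing the test over an orthonormal frame turns its first terms into the pairing of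
  \<open>Y\<close> with the tension field, which vanishes; a positive multiple of the squared norm
  of the differential is left, and it is at most 0.\<close>

lemma hilbert_schmidt_norm_zero_at_touching_point:
  fixes f :: "real^'m::finite \<Rightarrow> 'w::euclidean_space"
  assumes "open S" "x \<in> S" "smooth_on f S" "0 < c"
    and "\<And>y. y \<in> S \<Longrightarrow> c * sqrt (1 + (norm (f y - a))\<^sup>2) \<le> (f y - a) \<bullet> v + K"
    and "c * sqrt (1 + (norm (f x - a))\<^sup>2) = (f x - a) \<bullet> v + K"
    and sym: "transpose (g x) = g x" and pos: "\<And>v. v \<noteq> 0 \<Longrightarrow> 0 < v \<bullet> (g x *v v)"
    and harm: "tension_field g f x = 0"
  shows "hilbert_schmidt_norm g f x \<le> 0"
proof -
  define Y where "Y = 2 *\<^sub>R (c\<^sup>2 *\<^sub>R (f x - a) - ((f x - a) \<bullet> v + K) *\<^sub>R v)"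
  define \<kappa> where "\<kappa> = 2 * c\<^sup>2 / (1 + (norm (f x - a))\<^sup>2)"
  have "\<kappa> > 0"
    using \<open>0 < c\<close> by (simp add: \<kappa>_def add_pos_nonneg)
  note test = second_derivative_touching_hyperboloid[OF assms(1-6) Y_def refl refl]
  have "\<exists>e :: 'm \<Rightarrow> real^'m. \<forall>i j. matrix_inv (g x) $ i $ j = (\<Sum>a\<in>UNIV. e a $ i * e a $ j)"
    using sym pos by (rule matrix_inv_decomposition)
  then obtain e :: "'m \<Rightarrow> real^'m" where
    e: "\<forall>i j. matrix_inv (g x) $ i $ j = (\<Sum>a\<in>UNIV. e a $ i * e a $ j)" ..
  note trace = metric_trace_decomposition[OF e]
  define u where "u a = (\<Sum>i\<in>UNIV. (e a $ i) *\<^sub>R partial i f x)" for a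
  define z where "z a = (\<Sum>i\<in>UNIV. \<Sum>j\<in>UNIV. (e a $ i * e a $ j) *\<^sub>R partial i (partial j f) x)" for a
  \<comment> \<open>The first-order condition in the coordinate direction \<open>axis k 1\<close>.
    It makes the Christoffel terms disappear when the second fundamental form is paired with
    \<open>Y\<close>.\<close>
  have Y: "Y \<bullet> partial k f x = 0" for k
  proof -
    have "(\<Sum>i\<in>UNIV. (axis k 1 $ i) *\<^sub>R partial i f x) = (\<Sum>i\<in>UNIV. if i = k then partial k f x else 0)"
      by (intro sum.cong) (auto simp: axis_def)
    then show ?thesis
      using test(1)[of "axis k 1"] by simp
  qed
  have "Y \<bullet> second_fundamental_form g f x i j = Y \<bullet> partial i (partial j f) x" for i j
    by (simp add: second_fundamental_form_def inner_diff_right inner_sum_right Y)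
  then have "Y \<bullet> tension_field g f x = (\<Sum>a\<in>UNIV. Y \<bullet> z a)"
    by (simp add: tension_field_def trace inner_sum_right z_def)
  then have lin: "(\<Sum>a\<in>UNIV. Y \<bullet> z a) = 0"
    by (simp add: harm)
  have "metric_trace (g x) (\<lambda>i j. partial i f x \<bullet> partial j f x) = (\<Sum>a\<in>UNIV. u a \<bullet> u a)"
    by (simp add: trace inner_sum_left inner_sum_right mult.assoc sum_distrib_left u_def)
      (simp only: inner_commute)
  then have "\<kappa> * metric_trace (g x) (\<lambda>i j. partial i f x \<bullet> partial j f x) =
     (\<Sum>a\<in>UNIV. Y \<bullet> z a + \<kappa> * (u a \<bullet> u a))"
    unfolding sum.distrib lin by (simp add: sum_distrib_left)
  also have "\<dots> \<le> 0"
    unfolding \<kappa>_def u_def z_def by (intro sum_nonpos test(2))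
  \<comment> \<open>The real \<open>sqrt\<close> is odd, hence preserves sign, so a nonpositive
    trace gives a nonpositive norm.\<close>
  finally show ?thesis
    using \<open>\<kappa> > 0\<close> by (simp add: hilbert_schmidt_norm_def mult_le_0_iff)
qed

section \<open>Continuity on the manifold and existence of a maximum\<close>

text \<open>On each chart domain \<open>\<phi>\<close> is its coordinate expression after the chart
  map, a composition of continuous maps; the open chart domains cover \<open>X\<close>, so the
  pieces glue.\<close>

lemma (in smooth_manifold) continuous_map_smooth_map:
  fixes \<phi> :: "'a \<Rightarrow> 'w::euclidean_space"
  assumes "smooth_map A \<phi>"
  shows "continuous_map X euclidean \<phi>"
proof (rule pasting_lemma[where I = A and T = fst and f = "\<lambda>c. \<phi>"])
  fix c assume c: "c \<in> A"
  show "openin X (fst c)"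
    using c by (rule chart_domain_open)
  have inj: "inj_on (snd c) (fst c)"
    using homeomorphic_imp_injective_map[OF chart_homeomorphic[OF c]]
      openin_subset[OF chart_domain_open[OF c]]
    by (simp add: Int_absorb1)
  have "Ck_on 0 (in_coords \<phi> c) (coord_image c)"
    using assms c unfolding smooth_map_def smooth_on_def by blast
  then have "continuous_map (top_of_set (coord_image c)) euclidean (in_coords \<phi> c)"
    by simp
  then have "continuous_map (subtopology X (fst c)) euclidean (in_coords \<phi> c \<circ> snd c)"
    by (rule continuous_map_compose[OF homeomorphic_imp_continuous_map[OF chart_homeomorphic[OF c]]])
  then show "continuous_map (subtopology X (fst c)) euclidean \<phi>"
    by (rule continuous_map_eq) (auto simp: in_coords_def inj)
qed (use atlas_covers in blast)+

text \<open>A maximum over \<open>K\<close> is at least \<open>F q\<close>, and \<open>F q\<close>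
  dominates all values off \<open>K\<close>, so it is a global maximum.\<close>

lemma continuous_map_attains_sup:
  fixes F :: "'a \<Rightarrow> real"
  assumes "continuous_map X euclideanreal F" "compactin X K" "q \<in> K"
    and "\<And>p. p \<in> topspace X \<Longrightarrow> p \<notin> K \<Longrightarrow> F p \<le> F q"
  shows "\<exists>p\<in>topspace X. \<forall>p'\<in>topspace X. F p' \<le> F p"
proof -
  have "compact (F ` K)"
    using image_compactin[OF assms(2,1)] by simp
  then obtain p where p: "p \<in> K" "\<And>p'. p' \<in> K \<Longrightarrow> F p' \<le> F p"
    using compact_attains_sup[of "F ` K"] assms(3) by blast
  moreover have "K \<subseteq> topspace X"
    using assms(2) by (rule compactin_subset_topspace)
  ultimately show ?thesis
    using assms(3,4) order_trans by (metis subsetD)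
qed

theorem corollary1p10:
  fixes X :: "'a topology"
    and A :: "('a, 'm::finite) chart set"
    and G :: "('a, 'm) chart \<Rightarrow> real^'m \<Rightarrow> real^'m^'m"
  assumes "riemannian_manifold X A G"
    and "connected_space X"
    and "topspace X \<noteq> {}"
    and "CARD('m) \<ge> 2"
    and "CARD('n::finite) \<ge> 2"
  shows "\<not> (\<exists>\<phi> :: 'a \<Rightarrow> real^'n.
            proper_into X \<phi> \<and> harmonic_map A G \<phi> \<and>
            (\<forall>p\<in>topspace X. \<forall>c\<in>A. p \<in> fst c \<longrightarrow>
               hilbert_schmidt_norm (G c) (in_coords \<phi> c) (snd c p) > 0) \<and>
            (\<exists>C. nondegenerate_cone C \<and> \<phi> ` topspace X \<subseteq> C))"
proof (rule notI, elim exE conjE)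
  fix \<phi> :: "'a \<Rightarrow> real^'n" and C :: "(real^'n) set"
  assume proper: "proper_into X \<phi>" and harm: "harmonic_map A G \<phi>"
    and nz: "\<forall>p\<in>topspace X. \<forall>c\<in>A. p \<in> fst c \<longrightarrow>
               hilbert_schmidt_norm (G c) (in_coords \<phi> c) (snd c p) > 0"
    and "nondegenerate_cone C" and image: "\<phi> ` topspace X \<subseteq> C"
  interpret riemannian_manifold X A G by fact
  obtain a v \<theta> where \<theta>: "0 < \<theta>" "\<theta> < pi / 2" and C: "C = cone_set a v \<theta>"
    using \<open>nondegenerate_cone C\<close> by (auto simp: nondegenerate_cone_def)
  \<comment> \<open>Half the slope of the cone: the linear term of \<open>F\<close> contributes at
    most \<open>- 2 * c * norm (z - a)\<close> in the cone and the root grows only at rate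
    \<open>c\<close>, so a decay at rate \<open>c\<close> remains.\<close>
  define c where "c = cos \<theta> / 2"
  have "c > 0"
    using \<theta> by (auto simp: c_def intro!: cos_gt_zero)
  have cone: "2 * c * norm (\<phi> p - a) \<le> (\<phi> p - a) \<bullet> v" if "p \<in> topspace X" for p
  proof -
    have "\<phi> p \<in> cone_set a v \<theta>"
      using that image C by auto
    then have "norm (\<phi> p - a) > 0" "cos \<theta> \<le> ((\<phi> p - a) \<bullet> v) / norm (\<phi> p - a)"
      by (auto simp: cone_set_def divide_inverse_commute)
    then show ?thesis
      by (simp add: c_def pos_le_divide_eq)
  qed
  have smooth: "smooth_map A \<phi>"
    using harm by (simp add: harmonic_map_def)
  then have cont: "continuous_map X euclidean \<phi>"
    by (rule continuous_map_smooth_map)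
  define F where "F z = c * sqrt (1 + (norm (z - a))\<^sup>2) - (z - a) \<bullet> v" for z
  have "continuous_map X euclideanreal (F \<circ> \<phi>)"
    unfolding F_def by (rule continuous_map_compose[OF cont]) (auto intro!: continuous_intros)
  then have contF: "continuous_map X euclideanreal (\<lambda>p. F (\<phi> p))"
    by (simp add: o_def)
  have decay: "F (\<phi> p) \<le> c - c * norm (\<phi> p - a)" if "p \<in> topspace X" for p
  proof -
    have "sqrt (1 + (norm (\<phi> p - a))\<^sup>2) \<le> 1 + norm (\<phi> p - a)"
      using sqrt_add_le_add_sqrt[of 1 "(norm (\<phi> p - a))\<^sup>2"] by simp
    then have "c * sqrt (1 + (norm (\<phi> p - a))\<^sup>2) \<le> c * (1 + norm (\<phi> p - a))"
      using \<open>c > 0\<close> by simp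
    then show ?thesis
      using cone[OF that] by (simp add: F_def algebra_simps)
  qed
  obtain q where q: "q \<in> topspace X"
    using assms(3) by blast
  \<comment> \<open>The first entry puts \<open>q\<close> into the compact preimage of the ball;
    beyond the second, \<open>decay\<close> pushes \<open>F\<close> below its value at
    \<open>q\<close>.\<close>
  define R where "R = max (norm (\<phi> q - a)) (1 - F (\<phi> q) / c)"
  have "compactin X {p \<in> topspace X. \<phi> p \<in> cball a R}"
    using proper compact_cball unfolding proper_into_def by blast
  moreover have "q \<in> {p \<in> topspace X. \<phi> p \<in> cball a R}"
    using q by (simp add: R_def dist_norm norm_minus_commute)
  moreover have "F (\<phi> p) \<le> F (\<phi> q)" if "p \<in> topspace X" "p \<notin> {p \<in> topspace X. \<phi> p \<in> cball a R}" for p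
  proof -
    have "1 - F (\<phi> q) / c \<le> norm (\<phi> p - a)"
      using that by (simp add: R_def dist_norm norm_minus_commute)
    then have "c - c * norm (\<phi> p - a) \<le> F (\<phi> q)"
      using \<open>c > 0\<close> by (simp add: field_simps)
    then show ?thesis
      using decay[OF that(1)] by simp
  qed
  ultimately have "\<exists>p\<in>topspace X. \<forall>p'\<in>topspace X. F (\<phi> p') \<le> F (\<phi> p)"
    by (rule continuous_map_attains_sup[OF contF])
  then obtain p where p: "p \<in> topspace X" "\<And>p'. p' \<in> topspace X \<Longrightarrow> F (\<phi> p') \<le> F (\<phi> p)"
    by blast
  obtain ch where ch: "ch \<in> A" "p \<in> fst ch"
    using p(1) atlas_covers by blast
  let ?f = "in_coords \<phi> ch" and ?x = "snd ch p"
  have sub: "fst ch \<subseteq> topspace X"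
    using openin_subset[OF chart_domain_open[OF ch(1)]] .
  then have "inj_on (snd ch) (fst ch)"
    using homeomorphic_imp_injective_map[OF chart_homeomorphic[OF ch(1)]]
    by (simp add: Int_absorb1)
  then have fx: "?f ?x = \<phi> p"
    using ch(2) by (simp add: in_coords_def)
  have x: "?x \<in> coord_image ch"
    using ch(2) by (simp add: coord_image_def)
  \<comment> \<open>The global maximum at \<open>p\<close> is a maximum over the whole coordinate
    image.\<close>
  have fy: "F (?f y) \<le> F (\<phi> p)" if "y \<in> coord_image ch" for y
  proof -
    have "inv_into (fst ch) (snd ch) y \<in> topspace X"
      using that sub inv_into_into[of y "snd ch" "fst ch"] by (auto simp: coord_image_def)
    then show ?thesis
      using p(2) by (simp add: in_coords_def)
  qed
  \<comment> \<open>The constant \<open>K\<close> is the maximal value \<open>F (\<phi> p)\<close>: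
    the image of the chart lies on one side of this level set of \<open>F\<close> and touches it at
    \<open>\<phi> p\<close>.\<close>
  have "hilbert_schmidt_norm (G ch) ?f ?x \<le> 0"
  proof (rule hilbert_schmidt_norm_zero_at_touching_point)
    show "open (coord_image ch)" "?x \<in> coord_image ch" "0 < c"
      using coord_image_open[OF ch(1)] x \<open>c > 0\<close> by auto
    show "smooth_on ?f (coord_image ch)"
      using smooth ch(1) by (simp add: smooth_map_def)
    show "c * sqrt (1 + (norm (?f y - a))\<^sup>2) \<le> (?f y - a) \<bullet> v + F (\<phi> p)"
      if "y \<in> coord_image ch" for y
      using fy[OF that] by (simp add: F_def)
    show "c * sqrt (1 + (norm (?f ?x - a))\<^sup>2) = (?f ?x - a) \<bullet> v + F (\<phi> p)"
      by (simp add: F_def fx)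
    show "transpose (G ch ?x) = G ch ?x"
      using metric_symmetric ch(1) x by blast
    show "0 < v \<bullet> (G ch ?x *v v)" if "v \<noteq> 0" for v
      using metric_pos_def ch(1) x that by blast
    show "tension_field (G ch) ?f ?x = 0"
      using harm ch by (auto simp: harmonic_map_def)
  qed
  moreover have "hilbert_schmidt_norm (G ch) ?f ?x > 0"
    using nz p(1) ch by blast
  ultimately show False
    by simp
qed

end
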